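(* Let $G$ be a group with finite abelianization $G/G'$. Suppose that the group $\bar G$ admits a stably unbounded norm. Then $\bar G$ admits a non-trivial homogeneous quasi-morphism.
   Context: For a group $G$, $\bar G$ denotes the extension of $G\times G$ by an element $t$ with $t^2=1$ and $t(g_1,g_2)t^{-1}=(g_2,g_1)$ for all $g_1,g_2\in G$; that is, $\bar G=(G\times G)\rtimes\mathbb{Z}/2$ with $\mathbb{Z}/2$ acting by swapping the factors. A norm on a group $\Gamma$ means a conjugation-invariant norm: a function $\nu:\Gamma\to[0,+\infty)$ such that $\nu(1)=0$; $\nu(f)=\nu(f^{-1})$; $\nu(fg)\le\nu(f)+\nu(g)$; $\nu(gfg^{-1})=\nu(f)$ for all $f,g\in \Gamma$; and $\nu(f)>0$ for all $f\ne1$. Its stabilization is $\nu_\infty(f)=\lim_{n\to\infty}\nu(f^n)/n$. An unbounded norm $\nu$ is stably unbounded if $\nu_\infty(f)\neq0$ for some $f\in \Gamma$. A function $r:\Gamma\to\mathbb{R}$ is a quasi-morphism if there is $C>0$ with $|r(ab)-r(a)-r(b)|\le C$ for all $a,b\in \Gamma$. It is homogeneous if $r(a^n)=nr(a)$ for all $a\in \Gamma$, $n\in\mathbb{Z}$. It is non-trivial if it is not a homomorphism. *)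

theory Defs
  imports Complex_Main "HOL-Algebra.Algebra"
begin

definition semidirect_product ::
  "('a, 'c) monoid_scheme \<Rightarrow> ('b, 'd) monoid_scheme \<Rightarrow> ('b \<Rightarrow> 'a \<Rightarrow> 'a) \<Rightarrow> ('a \<times> 'b) monoid"
  where
  "semidirect_product N H \<phi> =
     \<lparr>carrier = carrier N \<times> carrier H,
      monoid.mult = (\<lambda>(n, h) (n', h'). (n \<otimes>\<^bsub>N\<^esub> \<phi> h n', h \<otimes>\<^bsub>H\<^esub> h')),
      one = (\<one>\<^bsub>N\<^esub>, \<one>\<^bsub>H\<^esub>)\<rparr>"

definition swap_action :: "int \<Rightarrow> 'a \<times> 'a \<Rightarrow> 'a \<times> 'a"
  where "swap_action k = (if k = 0 then id else prod.swap)"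

definition swap_extension :: "('a, 'b) monoid_scheme \<Rightarrow> (('a \<times> 'a) \<times> int) monoid"
  where "swap_extension G = semidirect_product (G \<times>\<times> G) (integer_mod_group 2) swap_action"

lemma carrier_swap_extension:
  "carrier (swap_extension G) = (carrier G \<times> carrier G) \<times> {0, 1}"
  by (auto simp: swap_extension_def semidirect_product_def carrier_integer_mod_group)

lemma one_swap_extension: "\<one>\<^bsub>swap_extension G\<^esub> = ((\<one>\<^bsub>G\<^esub>, \<one>\<^bsub>G\<^esub>), 0)"
  by (simp add: swap_extension_def semidirect_product_def)

lemma mult_swap_extension:
  "((a, b), k) \<otimes>\<^bsub>swap_extension G\<^esub> ((c, d), l) =
     (if k = 0 then (a \<otimes>\<^bsub>G\<^esub> c, b \<otimes>\<^bsub>G\<^esub> d) else (a \<otimes>\<^bsub>G\<^esub> d, b \<otimes>\<^bsub>G\<^esub> c), (k + l) mod 2)"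
  by (simp add: swap_extension_def semidirect_product_def swap_action_def)

lemma group_swap_extension:
  assumes "group G"
  shows "group (swap_extension G)"
proof -
  interpret G: group G by (rule assms)
  show ?thesis
  proof (rule groupI, goal_cases)
    case (5 x)
    then obtain a b k where x: "x = ((a, b), k)" "a \<in> carrier G" "b \<in> carrier G" "k = 0 \<or> k = 1"
      by (auto simp: carrier_swap_extension)
    show ?case
      by (rule bexI[of _ "(if k = 0 then (inv\<^bsub>G\<^esub> a, inv\<^bsub>G\<^esub> b) else (inv\<^bsub>G\<^esub> b, inv\<^bsub>G\<^esub> a), k)"])
        (use x in \<open>auto simp: carrier_swap_extension one_swap_extension mult_swap_extension\<close>)
  qed (auto simp: carrier_swap_extension one_swap_extension mult_swap_extension G.m_assoc)
qed

text \<open>The adjoined involution is $t = ((1, 1), 1)$, and $(g_1, g_2)$ is embedded as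
  $((g_1, g_2), 0)$.\<close>

lemma swap_extension_involution:
  assumes "group G"
  defines "t \<equiv> ((\<one>\<^bsub>G\<^esub>, \<one>\<^bsub>G\<^esub>), 1)"
  shows "t \<otimes>\<^bsub>swap_extension G\<^esub> t = \<one>\<^bsub>swap_extension G\<^esub>"
  using group.is_monoid[OF assms(1)]
  by (simp add: t_def mult_swap_extension one_swap_extension)

lemma swap_extension_conj:
  assumes "group G" "g1 \<in> carrier G" "g2 \<in> carrier G"
  defines "t \<equiv> ((\<one>\<^bsub>G\<^esub>, \<one>\<^bsub>G\<^esub>), 1)"
  shows "t \<otimes>\<^bsub>swap_extension G\<^esub> ((g1, g2), 0) \<otimes>\<^bsub>swap_extension G\<^esub>
           inv\<^bsub>swap_extension G\<^esub> t = ((g2, g1), 0)"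
proof -
  interpret G: group G by (rule assms(1))
  interpret E: group "swap_extension G" by (rule group_swap_extension[OF assms(1)])
  have "t \<in> carrier (swap_extension G)"
    by (simp add: t_def carrier_swap_extension)
  then have "inv\<^bsub>swap_extension G\<^esub> t = t"
    using swap_extension_involution[OF assms(1)] by (simp add: t_def E.inv_equality)
  then show ?thesis
    using assms(2,3) by (simp add: t_def mult_swap_extension)
qed

definition conj_invariant_norm :: "('a, 'b) monoid_scheme \<Rightarrow> ('a \<Rightarrow> real) \<Rightarrow> bool"
  where
  "conj_invariant_norm \<Gamma> \<nu> \<longleftrightarrow>
     (\<forall>f \<in> carrier \<Gamma>. 0 \<le> \<nu> f) \<and>
     \<nu> \<one>\<^bsub>\<Gamma>\<^esub> = 0 \<and>
     (\<forall>f \<in> carrier \<Gamma>. \<nu> (inv\<^bsub>\<Gamma>\<^esub> f) = \<nu> f) \<and>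
     (\<forall>f \<in> carrier \<Gamma>. \<forall>g \<in> carrier \<Gamma>. \<nu> (f \<otimes>\<^bsub>\<Gamma>\<^esub> g) \<le> \<nu> f + \<nu> g) \<and>
     (\<forall>f \<in> carrier \<Gamma>. \<forall>g \<in> carrier \<Gamma>. \<nu> (g \<otimes>\<^bsub>\<Gamma>\<^esub> f \<otimes>\<^bsub>\<Gamma>\<^esub> inv\<^bsub>\<Gamma>\<^esub> g) = \<nu> f) \<and>
     (\<forall>f \<in> carrier \<Gamma>. f \<noteq> \<one>\<^bsub>\<Gamma>\<^esub> \<longrightarrow> 0 < \<nu> f)"

text \<open>For a norm on a group the limit exists, since $n \mapsto \nu(f^n)$ is subadditive.\<close>

definition stabilization :: "('a, 'b) monoid_scheme \<Rightarrow> ('a \<Rightarrow> real) \<Rightarrow> 'a \<Rightarrow> real"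
  where "stabilization \<Gamma> \<nu> f = lim (\<lambda>n::nat. \<nu> (f [^]\<^bsub>\<Gamma>\<^esub> n) / real n)"

text \<open>Norms are nonnegative, so boundedness is boundedness above.\<close>

definition stably_unbounded_norm :: "('a, 'b) monoid_scheme \<Rightarrow> ('a \<Rightarrow> real) \<Rightarrow> bool"
  where
  "stably_unbounded_norm \<Gamma> \<nu> \<longleftrightarrow>
     conj_invariant_norm \<Gamma> \<nu> \<and> \<not> bdd_above (\<nu> ` carrier \<Gamma>) \<and>
     (\<exists>f \<in> carrier \<Gamma>. stabilization \<Gamma> \<nu> f \<noteq> 0)"

definition quasi_morphism :: "('a, 'b) monoid_scheme \<Rightarrow> ('a \<Rightarrow> real) \<Rightarrow> bool"
  where
  "quasi_morphism \<Gamma> r \<longleftrightarrow>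
     (\<exists>C>0. \<forall>a \<in> carrier \<Gamma>. \<forall>b \<in> carrier \<Gamma>. \<bar>r (a \<otimes>\<^bsub>\<Gamma>\<^esub> b) - r a - r b\<bar> \<le> C)"

definition homogeneous :: "('a, 'b) monoid_scheme \<Rightarrow> ('a \<Rightarrow> real) \<Rightarrow> bool"
  where
  "homogeneous \<Gamma> r \<longleftrightarrow> (\<forall>a \<in> carrier \<Gamma>. \<forall>n::int. r (a [^]\<^bsub>\<Gamma>\<^esub> n) = real_of_int n * r a)"

definition real_homomorphism :: "('a, 'b) monoid_scheme \<Rightarrow> ('a \<Rightarrow> real) \<Rightarrow> bool"
  where
  "real_homomorphism \<Gamma> r \<longleftrightarrow>
     (\<forall>a \<in> carrier \<Gamma>. \<forall>b \<in> carrier \<Gamma>. r (a \<otimes>\<^bsub>\<Gamma>\<^esub> b) = r a + r b)"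

end

theory Submission
  imports Defs
begin

text \<open>
  Let $\bar G$ be the swap extension, \<open>\<nu>\<close> a norm on it and \<open>f\<close> an element with
  $\nu_\infty(f) \ne 0$. The proof rests on three facts.

  The commutators of $\bar G$ have bounded norm. If \<open>t x t\<inverse>\<close> commutes with \<open>y\<close>, then
  $[x, y] = [[x, t], y]$, and a commutator has norm at most twice that of either entry, so
  $\nu([x, y]) \le 4 \nu(t)$
  (\<open>norm_commutator_displaced\<close>). The involution \<open>t\<close> moves $G \times 1$ to $1 \times G$, so this applies
  to any two elements of $G \times 1$; and every element of $\bar G$ is a product of three factors
  from $G \times 1$, $1 \times G$ and $\{1, t\}$ (\<open>swap_extension_norm_commutator_bound\<close>).

  On a group whose commutators have norm at most \<open>K\<close>, an element \<open>f\<close> with $\nu(f^n) \ge c n$ is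
  detected by a homogeneous quasi-morphism \<open>r\<close> with $r(f) \ge c$
  (\<open>homogeneous_quasimorphism_of_linear_growth\<close>). Consider sequences \<open>x\<close> in the group with
  $\nu(x_n) = O(n)$. The growth rate $p(x) = \limsup \nu(x_n)/n$ is subadditive and does not notice a
  commutator, whose norm is bounded in \<open>n\<close>; hence the sequences behave like an abelian group under
  \<open>p\<close>, and the Hahn--Banach argument yields a homomorphism \<open>\<phi>\<close> to the reals with $\phi \le p$ and
  $\phi((f^n)_n) \ge c$. Put $r(g) = \phi((g^n)_n)$. Since $(gh)^n$ is obtained from $g^n h^n$ by \<open>n\<close>
  commutators, the sequence $g^n h^n (gh)^{-n}$ has growth rate at most \<open>K\<close>, which bounds the defect
  of \<open>r\<close>. The positivity of $\nu_\infty(f)$ provides \<open>c > 0\<close> (\<open>linear_growth_of_stabilization\<close>).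

  Finally, every homomorphism from $\bar G$ to the reals vanishes, because \<open>G\<close> has finite
  abelianization and $t^2 = 1$ (\<open>swap_extension_real_homomorphism_zero\<close>). As \<open>r(f) > 0\<close>, the
  quasi-morphism \<open>r\<close> is not a homomorphism.
\<close>

section \<open>A Hahn--Banach theorem for subadditive functions on groups\<close>

text \<open>Such a \<open>p\<close> is constant on the fibres of the abelianization. Working with this symmetry of \<open>p\<close>
  replaces passing to a quotient of \<open>H\<close>.\<close>

definition abelian_subadditive :: "('a, 'b) monoid_scheme \<Rightarrow> ('a \<Rightarrow> real) \<Rightarrow> bool"
  where
  "abelian_subadditive H p \<longleftrightarrow>
     (\<forall>x \<in> carrier H. \<forall>y \<in> carrier H. p (x \<otimes>\<^bsub>H\<^esub> y) \<le> p x + p y) \<and>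
     (\<forall>x \<in> carrier H. \<forall>y \<in> carrier H. \<forall>z \<in> carrier H.
        p (x \<otimes>\<^bsub>H\<^esub> y \<otimes>\<^bsub>H\<^esub> z) = p (y \<otimes>\<^bsub>H\<^esub> x \<otimes>\<^bsub>H\<^esub> z))"

definition sublinear :: "('a, 'b) monoid_scheme \<Rightarrow> ('a \<Rightarrow> real) \<Rightarrow> bool"
  where
  "sublinear H p \<longleftrightarrow> abelian_subadditive H p \<and>
     (\<forall>x \<in> carrier H. \<forall>n::nat. p (x [^]\<^bsub>H\<^esub> n) = real n * p x)"

context group
begin

lemma abelian_subadditive_mult:
  "abelian_subadditive G p \<Longrightarrow> x \<in> carrier G \<Longrightarrow> y \<in> carrier G \<Longrightarrow> p (x \<otimes> y) \<le> p x + p y"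
  by (simp add: abelian_subadditive_def)

lemma abelian_subadditive_swap:
  assumes "abelian_subadditive G p"
    and "u \<in> carrier G" "x \<in> carrier G" "y \<in> carrier G" "z \<in> carrier G"
  shows "p (u \<otimes> x \<otimes> y \<otimes> z) = p (u \<otimes> y \<otimes> x \<otimes> z)"
proof -
  have sw: "p (a \<otimes> b \<otimes> c) = p (b \<otimes> a \<otimes> c)"
    if "a \<in> carrier G" "b \<in> carrier G" "c \<in> carrier G" for a b c
    using assms(1) that by (simp add: abelian_subadditive_def)
  have "p (u \<otimes> x \<otimes> y \<otimes> z) = p (y \<otimes> (u \<otimes> x) \<otimes> z)"
    using sw[of "u \<otimes> x" y z] assms by simp
  also have "\<dots> = p (y \<otimes> u \<otimes> (x \<otimes> z))"
    using assms by (simp add: m_assoc)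
  also have "\<dots> = p (u \<otimes> y \<otimes> (x \<otimes> z))"
    using sw[of y u "x \<otimes> z"] assms by simp
  finally show ?thesis
    using assms by (simp add: m_assoc)
qed

lemma abelian_subadditive_power_mult:
  assumes p: "abelian_subadditive G p"
    and xy: "x \<in> carrier G" "y \<in> carrier G" and "z \<in> carrier G"
  shows "p ((x \<otimes> y) [^] (n::nat) \<otimes> z) = p (x [^] n \<otimes> y [^] n \<otimes> z)"
  using \<open>z \<in> carrier G\<close>
proof (induction n arbitrary: z)
  case (Suc n)
  have "p ((x \<otimes> y) [^] Suc n \<otimes> z) = p ((x \<otimes> y) [^] n \<otimes> (x \<otimes> y \<otimes> z))"
    using Suc.prems xy by (simp add: m_assoc)
  also have "\<dots> = p (x [^] n \<otimes> y [^] n \<otimes> (x \<otimes> y \<otimes> z))"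
    using Suc xy by simp
  also have "\<dots> = p (x [^] n \<otimes> y [^] n \<otimes> x \<otimes> (y \<otimes> z))"
    using Suc.prems xy by (simp add: m_assoc)
  also have "\<dots> = p (x [^] n \<otimes> x \<otimes> y [^] n \<otimes> (y \<otimes> z))"
    using abelian_subadditive_swap[OF p, of "x [^] n" "y [^] n" x "y \<otimes> z"] Suc.prems xy by simp
  also have "\<dots> = p (x [^] Suc n \<otimes> y [^] Suc n \<otimes> z)"
    using Suc.prems xy by (simp add: m_assoc)
  finally show ?case .
qed simp

lemma abelian_subadditive_power_mult':
  assumes "abelian_subadditive G p" "x \<in> carrier G" "y \<in> carrier G"
  shows "p ((x \<otimes> y) [^] (n::nat)) = p (x [^] n \<otimes> y [^] n)"
  using abelian_subadditive_power_mult[OF assms, of \<one> n] assms by simp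

lemma abelian_subadditive_power_le:
  assumes p: "abelian_subadditive G p" and x: "x \<in> carrier G" and "0 < n"
  shows "p (x [^] n) \<le> real n * p x"
  using \<open>0 < n\<close>
proof (induction n rule: nat_induct_non_zero)
  case (Suc n)
  then show ?case
    using abelian_subadditive_mult[OF p, of "x [^] n" x] x by (simp add: algebra_simps)
qed (use x in simp)

text \<open>The infimum of $p(x^k)/k$ over $k \ge 1$ is the stable version of \<open>p\<close>. Subadditivity survives
  because $p((xy)^{kl}) \le p(x^{kl}) + p(y^{kl}) \le l\, p(x^k) + k\, p(y^l)$, where the first step
  reorders the letters of $(xy)^{kl}$ at no cost.\<close>

lemma sublinear_homogenization:
  assumes p: "abelian_subadditive G p" and nonneg: "\<forall>x \<in> carrier G. 0 \<le> p x" and "p \<one> = 0"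
  obtains q where "sublinear G q"
    and "\<And>x. x \<in> carrier G \<Longrightarrow> q x \<le> p x"
    and "\<And>x c. x \<in> carrier G \<Longrightarrow> \<forall>n::nat. c * real n \<le> p (x [^] n) \<Longrightarrow> c \<le> q x"
proof -
  define q where "q = (\<lambda>x. INF k::nat. p (x [^] Suc k) / real (Suc k))"
  have q_le: "q x \<le> p (x [^] Suc k) / real (Suc k)" if "x \<in> carrier G" for x k
    unfolding q_def using nonneg that
    by (intro cINF_lower) (auto intro!: bdd_belowI[of _ 0] simp del: nat_pow_Suc)
  have q_ge: "c \<le> q x" if "\<And>k. c \<le> p (x [^] Suc k) / real (Suc k)" for x c
    unfolding q_def by (intro cINF_greatest) (use that in auto)
  have q_le_p: "q x \<le> p x" if "x \<in> carrier G" for x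
    using q_le[OF that, of 0] that by simp
  have q_lower: "c \<le> q x"
    if x: "x \<in> carrier G" and c: "\<forall>n::nat. c * real n \<le> p (x [^] n)" for x c
  proof (rule q_ge)
    fix k
    show "c \<le> p (x [^] Suc k) / real (Suc k)"
      using c[rule_format, of "Suc k"] by (simp add: pos_le_divide_eq del: nat_pow_Suc)
  qed
  have "q (x \<otimes> y) \<le> q x + q y" if xy: "x \<in> carrier G" "y \<in> carrier G" for x y
  proof -
    have key: "q (x \<otimes> y) \<le> p (x [^] Suc k) / real (Suc k) + p (y [^] Suc l) / real (Suc l)" for k l
    proof -
      obtain m where m: "Suc m = Suc k * Suc l"
        by (cases "Suc k * Suc l") auto
      have "p ((x \<otimes> y) [^] Suc m) \<le> p (x [^] Suc m) + p (y [^] Suc m)"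
        unfolding abelian_subadditive_power_mult'[OF p xy]
        by (rule abelian_subadditive_mult[OF p]) (use xy in auto)
      also have "p (x [^] Suc m) \<le> real (Suc l) * p (x [^] Suc k)"
        using abelian_subadditive_power_le[OF p, of "x [^] Suc k" "Suc l"] xy
        unfolding m nat_pow_pow[OF xy(1)] by (simp del: nat_pow_Suc mult_Suc mult_Suc_right)
      also have "p (y [^] Suc m) \<le> real (Suc k) * p (y [^] Suc l)"
        using abelian_subadditive_power_le[OF p, of "y [^] Suc l" "Suc k"] xy
        unfolding m nat_pow_pow[OF xy(2)] mult.commute[of "Suc l"]
        by (simp del: nat_pow_Suc mult_Suc mult_Suc_right)
      finally have "p ((x \<otimes> y) [^] Suc m) / real (Suc m)
          \<le> (real (Suc l) * p (x [^] Suc k) + real (Suc k) * p (y [^] Suc l)) / real (Suc m)"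
        by (simp add: divide_right_mono del: nat_pow_Suc)
      also have "\<dots> = p (x [^] Suc k) / real (Suc k) + p (y [^] Suc l) / real (Suc l)"
        unfolding m of_nat_mult by (simp add: field_simps del: nat_pow_Suc of_nat_Suc)
      finally show ?thesis
        using q_le[of "x \<otimes> y" m] xy by simp
    qed
    have "q (x \<otimes> y) - p (y [^] Suc l) / real (Suc l) \<le> q x" for l
      using key[of _ l] by (intro q_ge) (simp add: algebra_simps del: nat_pow_Suc)
    then have "q (x \<otimes> y) - q x \<le> q y"
      by (intro q_ge) (simp add: algebra_simps del: nat_pow_Suc)
    then show ?thesis
      by simp
  qed
  moreover have "q (x \<otimes> y \<otimes> z) = q (y \<otimes> x \<otimes> z)"
    if xyz: "x \<in> carrier G" "y \<in> carrier G" "z \<in> carrier G" for x y z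
  proof -
    have pow: "p ((a \<otimes> b \<otimes> z) [^] k) = p (a [^] k \<otimes> b [^] k \<otimes> z [^] k)"
      if "a \<in> carrier G" "b \<in> carrier G" for a b and k :: nat
      using abelian_subadditive_power_mult'[OF p, of "a \<otimes> b" z k]
        abelian_subadditive_power_mult[OF p, of a b "z [^] k" k] that xyz by simp
    have "p ((x \<otimes> y \<otimes> z) [^] k) = p ((y \<otimes> x \<otimes> z) [^] k)" for k :: nat
      using pow[of x y k] pow[of y x k] xyz
        abelian_subadditive_swap[OF p, of \<one> "x [^] k" "y [^] k" "z [^] k"] by simp
    then show ?thesis
      unfolding q_def by presburger
  qed
  ultimately have sub: "abelian_subadditive G q"
    unfolding abelian_subadditive_def by blast
  have "q (x [^] n) = real n * q x" if x: "x \<in> carrier G" for x and n :: nat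
  proof (cases n)
    case 0
    then show ?thesis
      using q_le[of \<one> 0] q_ge[of 0 \<one>] \<open>p \<one> = 0\<close> by simp
  next
    case (Suc m)
    have "q (x [^] n) / n \<le> q x"
    proof (rule q_ge)
      fix k
      have "q (x [^] n) \<le> p ((x [^] Suc k) [^] n) / real (Suc k)"
        using q_le[of "x [^] n" k] x by (metis nat_pow_pow mult.commute nat_pow_closed)
      also have "\<dots> \<le> real n * p (x [^] Suc k) / real (Suc k)"
        using abelian_subadditive_power_le[OF p, of "x [^] Suc k" n] x Suc
        by (simp add: divide_right_mono del: nat_pow_Suc of_nat_Suc)
      finally show "q (x [^] n) / n \<le> p (x [^] Suc k) / real (Suc k)"
        using Suc by (simp add: field_simps del: nat_pow_Suc of_nat_Suc)
    qed
    moreover have "n * q x \<le> q (x [^] n)"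
    proof (rule q_ge)
      fix k
      obtain l where l: "Suc l = n * Suc k"
        using Suc by (cases "n * Suc k") auto
      have "q x \<le> p ((x [^] n) [^] Suc k) / (real n * real (Suc k))"
        using q_le[OF x, of l] unfolding l nat_pow_pow[OF x] of_nat_mult .
      then show "n * q x \<le> p ((x [^] n) [^] Suc k) / real (Suc k)"
        using Suc by (simp add: field_simps del: nat_pow_Suc of_nat_Suc)
    qed
    ultimately show ?thesis
      using Suc by (simp add: field_simps del: of_nat_Suc)
  qed
  then have "sublinear G q"
    unfolding sublinear_def using sub by blast
  then show thesis
    using q_le_p q_lower by (rule that)
qed

lemma sublinear_power:
  "sublinear G q \<Longrightarrow> x \<in> carrier G \<Longrightarrow> q (x [^] (n::nat)) = real n * q x"
  by (simp add: sublinear_def)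

lemma sublinear_one: "sublinear G q \<Longrightarrow> q \<one> = 0"
  using sublinear_power[of q \<one> 0] by simp

lemma sublinear_mult:
  "sublinear G q \<Longrightarrow> x \<in> carrier G \<Longrightarrow> y \<in> carrier G \<Longrightarrow> q (x \<otimes> y) \<le> q x + q y"
  by (simp add: sublinear_def abelian_subadditive_mult)

lemma sublinear_ge_neg_inv:
  assumes "sublinear G q" "x \<in> carrier G"
  shows "- q (inv x) \<le> q x"
  using sublinear_mult[OF assms(1), of x "inv x"] sublinear_one[OF assms(1)] assms(2) by simp

text \<open>The step that makes minimal sublinear functions additive: the infimum of
  $q(v w^n) - n\, q(w)$ over \<open>n\<close> lies below \<open>q\<close> and drops at $w^{-1}$ to
  $-q(w)$ or less, the value there of any homomorphism that agrees with \<open>q\<close> at \<open>w\<close>.\<close>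

lemma sublinear_shift:
  assumes q: "sublinear G q" and w: "w \<in> carrier G"
  obtains s where "sublinear G s" "\<And>v. v \<in> carrier G \<Longrightarrow> s v \<le> q v" "s (inv w) \<le> - q w"
proof -
  define s where "s = (\<lambda>v. INF n::nat. q (v \<otimes> w [^] n) - real n * q w)"
  have cs: "abelian_subadditive G q"
    using q by (simp add: sublinear_def)
  have s_le: "s v \<le> q (v \<otimes> w [^] n) - real n * q w" if v: "v \<in> carrier G" for v and n :: nat
    unfolding s_def
  proof (rule cINF_lower)
    \<comment> \<open>The infimum is finite: homogeneity gives $q(w^n) = n\, q(w)$, and $w^n = v^{-1} (v w^n)$.\<close>
    have "- q (inv v) \<le> q (v \<otimes> w [^] n) - real n * q w" for n :: nat
      using sublinear_mult[OF q, of "inv v" "v \<otimes> w [^] n"] sublinear_power[OF q w, of n] v w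
      by (simp add: m_assoc[symmetric])
    then show "bdd_below (range (\<lambda>n::nat. q (v \<otimes> w [^] n) - real n * q w))"
      by (intro bdd_belowI[of _ "- q (inv v)"]) auto
  qed simp
  have s_ge: "c \<le> s v" if "\<And>n::nat. c \<le> q (v \<otimes> w [^] n) - real n * q w" for v c
    unfolding s_def by (intro cINF_greatest) (use that in auto)
  have le: "s v \<le> q v" if "v \<in> carrier G" for v
    using s_le[OF that, of 0] that by simp
  have s_inv: "s (inv w) \<le> - q w"
    using s_le[of "inv w" 1] w sublinear_one[OF q] by simp
  have "s (x \<otimes> y) \<le> s x + s y" if xy: "x \<in> carrier G" "y \<in> carrier G" for x y
  proof -
    have key: "s (x \<otimes> y) \<le> (q (x \<otimes> w [^] m) - real m * q w) + (q (y \<otimes> w [^] n) - real n * q w)"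
      for m n :: nat
    proof -
      have "s (x \<otimes> y) \<le> q (x \<otimes> y \<otimes> w [^] m \<otimes> w [^] n) - real (m + n) * q w"
        using s_le[of "x \<otimes> y" "m + n"] xy w by (simp add: nat_pow_mult m_assoc)
      also have "q (x \<otimes> y \<otimes> w [^] m \<otimes> w [^] n) = q (x \<otimes> w [^] m \<otimes> (y \<otimes> w [^] n))"
        using abelian_subadditive_swap[OF cs, of x y "w [^] m" "w [^] n"] xy w by (simp add: m_assoc)
      also have "\<dots> \<le> q (x \<otimes> w [^] m) + q (y \<otimes> w [^] n)"
        by (rule sublinear_mult[OF q]) (use xy w in auto)
      finally show ?thesis
        by (simp add: algebra_simps)
    qed
    have "s (x \<otimes> y) - (q (y \<otimes> w [^] n) - real n * q w) \<le> s x" for n :: nat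
      using key[of _ n] by (intro s_ge) (simp add: algebra_simps)
    then have "s (x \<otimes> y) - s x \<le> s y"
      by (intro s_ge) (simp add: algebra_simps)
    then show ?thesis
      by simp
  qed
  moreover have "s (x \<otimes> y \<otimes> z) = s (y \<otimes> x \<otimes> z)"
    if xyz: "x \<in> carrier G" "y \<in> carrier G" "z \<in> carrier G" for x y z
  proof -
    have "q (x \<otimes> y \<otimes> z \<otimes> w [^] n) = q (y \<otimes> x \<otimes> z \<otimes> w [^] n)" for n :: nat
      using abelian_subadditive_swap[OF cs, of \<one> x y "z \<otimes> w [^] n"] xyz w by (simp add: m_assoc)
    then show ?thesis
      unfolding s_def by simp
  qed
  ultimately have sub: "abelian_subadditive G s"
    unfolding abelian_subadditive_def by blast
  have "s (x [^] k) = real k * s x" if x: "x \<in> carrier G" for x and k :: nat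
  proof (cases k)
    case 0
    have "0 \<le> s \<one>"
      using w sublinear_power[OF q w] by (intro s_ge) simp
    then show ?thesis
      using 0 le[of \<one>] sublinear_one[OF q] by simp
  next
    case (Suc j)
    have "s (x [^] k) / k \<le> s x"
    proof (rule s_ge)
      fix n :: nat
      have "s (x [^] k) \<le> q (x [^] k \<otimes> (w [^] n) [^] k) - real (n * k) * q w"
        using s_le[of "x [^] k" "n * k"] x w by (simp add: nat_pow_pow)
      also have "q (x [^] k \<otimes> (w [^] n) [^] k) = q ((x \<otimes> w [^] n) [^] k)"
        using abelian_subadditive_power_mult'[OF cs x, of "w [^] n" k] w by simp
      also have "\<dots> = k * q (x \<otimes> w [^] n)"
        using x w by (simp add: sublinear_power[OF q])
      finally have "s (x [^] k) \<le> (q (x \<otimes> w [^] n) - real n * q w) * real k"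
        by (simp add: algebra_simps)
      moreover have "0 < real k"
        using Suc by simp
      ultimately show "s (x [^] k) / k \<le> q (x \<otimes> w [^] n) - real n * q w"
        by (simp only: pos_divide_le_eq)
    qed
    moreover have "k * s x \<le> s (x [^] k)"
    proof (rule s_ge)
      fix n :: nat
      have "k * s x \<le> k * (q (x \<otimes> w [^] n) - real n * q w)"
        using s_le[OF x, of n] by (simp add: mult_left_mono)
      also have "\<dots> = q ((x \<otimes> w [^] n) [^] k) - real (n * k) * q w"
        using x w by (simp add: sublinear_power[OF q] algebra_simps)
      also have "q ((x \<otimes> w [^] n) [^] k) = q (x [^] k \<otimes> (w [^] n) [^] k)"
        using abelian_subadditive_power_mult'[OF cs x, of "w [^] n" k] w by simp
      \<comment> \<open>Only \<open>n\<close> of the $nk$ factors \<open>w\<close> are kept; each of the others costs at most $q(w)$.\<close>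
      also have "(w [^] n) [^] k = w [^] n \<otimes> w [^] (n * j)"
        using w Suc by (simp add: nat_pow_pow nat_pow_mult add.commute del: nat_pow_Suc)
      also have "q (x [^] k \<otimes> (w [^] n \<otimes> w [^] (n * j)))
          \<le> q (x [^] k \<otimes> w [^] n) + real (n * j) * q w"
        using sublinear_mult[OF q, of "x [^] k \<otimes> w [^] n" "w [^] (n * j)"] x w
        by (simp add: m_assoc sublinear_power[OF q])
      finally show "k * s x \<le> q (x [^] k \<otimes> w [^] n) - real n * q w"
        using Suc by (simp add: algebra_simps)
    qed
    ultimately show ?thesis
      using Suc by (simp add: field_simps del: of_nat_Suc)
  qed
  then have "sublinear G s"
    unfolding sublinear_def using sub by blast
  then show thesis
    using le s_inv by (rule that)
qed

text \<open>Subadditivity passes to the infimum because two members of a chain have a smaller one, which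
  can be used for both summands.\<close>

lemma sublinear_Inf_chain:
  assumes "C \<noteq> {}" and sl: "\<And>q. q \<in> C \<Longrightarrow> sublinear G q"
    and chain: "\<And>q q'. q \<in> C \<Longrightarrow> q' \<in> C \<Longrightarrow> (\<forall>x. q x \<le> q' x) \<or> (\<forall>x. q' x \<le> q x)"
    and bdd: "\<And>x. x \<in> carrier G \<Longrightarrow> bdd_below ((\<lambda>q. q x) ` C)"
  shows "sublinear G (\<lambda>x. INF q\<in>C. q x)"
proof -
  define u where "u = (\<lambda>x. INF q\<in>C. q x)"
  have u_le: "u x \<le> q x" if "q \<in> C" "x \<in> carrier G" for q x
    unfolding u_def by (rule cINF_lower[OF bdd]) (use that in auto)
  have u_ge: "c \<le> u x" if "\<And>q. q \<in> C \<Longrightarrow> c \<le> q x" for c x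
    unfolding u_def by (rule cINF_greatest[OF \<open>C \<noteq> {}\<close>]) (use that in auto)
  have "u (x \<otimes> y) \<le> u x + u y" if xy: "x \<in> carrier G" "y \<in> carrier G" for x y
  proof -
    have key: "u (x \<otimes> y) \<le> q x + q' y" if "q \<in> C" "q' \<in> C" for q q'
    proof -
      have "\<exists>r\<in>C. (\<forall>z. r z \<le> q z) \<and> (\<forall>z. r z \<le> q' z)"
        using chain[of q q'] that order_refl by blast
      then obtain r where r: "r \<in> C" "\<forall>z. r z \<le> q z" "\<forall>z. r z \<le> q' z"
        by blast
      have "u (x \<otimes> y) \<le> r x + r y"
        using u_le[OF r(1), of "x \<otimes> y"] sublinear_mult[OF sl[OF r(1)] xy] xy by simp
      then show ?thesis
        using r(2)[rule_format, of x] r(3)[rule_format, of y] by linarith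
    qed
    have "u (x \<otimes> y) - q' y \<le> u x" if "q' \<in> C" for q'
      using key[OF _ that] by (intro u_ge) (simp add: algebra_simps)
    then have "u (x \<otimes> y) - u x \<le> u y"
      by (intro u_ge) (simp add: algebra_simps)
    then show ?thesis
      by simp
  qed
  moreover have "u (x \<otimes> y \<otimes> z) = u (y \<otimes> x \<otimes> z)"
    if xyz: "x \<in> carrier G" "y \<in> carrier G" "z \<in> carrier G" for x y z
    unfolding u_def using sl xyz
    by (intro INF_cong refl) (simp add: sublinear_def abelian_subadditive_def)
  moreover have "u (x [^] k) = real k * u x" if x: "x \<in> carrier G" for x and k :: nat
  proof (cases "k = 0")
    case True
    have "(INF q\<in>C. q \<one>) = (INF q\<in>C. 0)"
      using sublinear_one[OF sl] by (intro INF_cong refl)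
    then show ?thesis
      using True \<open>C \<noteq> {}\<close> by (simp add: u_def)
  next
    case False
    have "u (x [^] k) / k \<le> u x"
    proof (rule u_ge)
      fix q assume "q \<in> C"
      then show "u (x [^] k) / k \<le> q x"
        using u_le[of q "x [^] k"] x False sublinear_power[OF sl, of q x k]
        by (simp add: field_simps)
    qed
    moreover have "k * u x \<le> u (x [^] k)"
    proof (rule u_ge)
      fix q assume "q \<in> C"
      then show "k * u x \<le> q (x [^] k)"
        using u_le[of q x] x sublinear_power[OF sl, of q x k] by (simp add: mult_left_mono)
    qed
    ultimately show ?thesis
      using False by (simp add: field_simps)
  qed
  ultimately have "sublinear G u"
    unfolding sublinear_def abelian_subadditive_def by blast
  then show ?thesis
    by (simp add: u_def)
qed

lemma real_homomorphism_mult: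
  "real_homomorphism G \<phi> \<Longrightarrow> x \<in> carrier G \<Longrightarrow> y \<in> carrier G \<Longrightarrow> \<phi> (x \<otimes> y) = \<phi> x + \<phi> y"
  by (simp add: real_homomorphism_def)

lemma real_homomorphism_one: "real_homomorphism G \<phi> \<Longrightarrow> \<phi> \<one> = 0"
  using real_homomorphism_mult[of \<phi> \<one> \<one>] by simp

lemma real_homomorphism_inv:
  "real_homomorphism G \<phi> \<Longrightarrow> x \<in> carrier G \<Longrightarrow> \<phi> (inv x) = - \<phi> x"
  using real_homomorphism_mult[of \<phi> x "inv x"] real_homomorphism_one[of \<phi>] by simp

lemma real_homomorphism_nat_pow:
  assumes "real_homomorphism G \<phi>" "x \<in> carrier G"
  shows "\<phi> (x [^] (n::nat)) = real n * \<phi> x"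
  using assms
  by (induction n) (simp_all add: real_homomorphism_one real_homomorphism_mult algebra_simps)

text \<open>Hahn--Banach in the form that a minimal sublinear function is a homomorphism: shifting a minimal
  \<open>m\<close> along \<open>w\<close> returns \<open>m\<close>, so $m(w^{-1}) \le -m(w)$ for every \<open>w\<close>, which with
  subadditivity is additivity. Looking for \<open>m\<close> below the shift of \<open>p\<close> along \<open>x0\<close> forces the value
  at \<open>x0\<close>.\<close>

lemma sublinear_dominates_homomorphism:
  assumes p: "sublinear G p" and x0: "x0 \<in> carrier G"
  obtains \<phi> where "real_homomorphism G \<phi>" "\<And>x. x \<in> carrier G \<Longrightarrow> \<phi> x \<le> p x" "p x0 \<le> \<phi> x0"
proof -
  obtain p0 where p0: "sublinear G p0" "\<And>v. v \<in> carrier G \<Longrightarrow> p0 v \<le> p v" "p0 (inv x0) \<le> - p x0"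
    using sublinear_shift[OF p x0] by blast
  \<comment> \<open>A shift is bounded by the original function on the carrier only; the common value zero
    off the carrier makes the two comparable in the pointwise order used for minimality.\<close>
  define cut :: "('a \<Rightarrow> real) \<Rightarrow> 'a \<Rightarrow> real"
    where "cut q = (\<lambda>x. if x \<in> carrier G then q x else 0)" for q
  have cut_sl: "sublinear G (cut q)" if "sublinear G q" for q
    using that unfolding sublinear_def abelian_subadditive_def cut_def by simp
  define A where "A = {q. sublinear G q \<and> (\<forall>x. q x \<le> cut p0 x) \<and> (\<forall>x. x \<notin> carrier G \<longrightarrow> q x = 0)}"
  define P where "P = (\<lambda>q q' :: 'a \<Rightarrow> real. \<forall>x. q' x \<le> q x)"
  have base: "cut p0 \<in> A"
    using cut_sl[OF p0(1)] by (simp add: A_def cut_def)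
  have "\<exists>m\<in>A. \<forall>q\<in>A. P m q \<longrightarrow> q = m"
  proof (rule predicate_Zorn)
    show "partial_order_on A (relation_of P A)"
    proof (rule partial_order_on_relation_ofI)
      show "P a a" for a
        by (simp add: P_def)
      show "P a c" if "P a b" "P b c" for a b c
        using that unfolding P_def by (meson order_trans)
      show "a = b" if "P a b" "P b a" for a b
        using that unfolding P_def by (intro ext order_antisym) auto
    qed
    fix C assume C: "C \<in> Chains (relation_of P A)"
    then have CA: "C \<subseteq> A"
      by (auto simp: Chains_def relation_of_def)
    have chain: "(\<forall>x. q x \<le> q' x) \<or> (\<forall>x. q' x \<le> q x)" if "q \<in> C" "q' \<in> C" for q q'
      using C that unfolding Chains_def relation_of_def P_def by blast
    show "\<exists>u\<in>A. \<forall>a\<in>C. P a u"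
    proof (cases "C = {}")
      case True
      then show ?thesis
        using base by blast
    next
      case False
      define u where "u = (\<lambda>x. INF q\<in>C. q x)"
      have bdd: "bdd_below ((\<lambda>q. q x) ` C)" for x
      proof (cases "x \<in> carrier G")
        case True
        \<comment> \<open>All members of a chain share a lower bound, as $q(x) \ge -q(x^{-1}) \ge -p_0(x^{-1})$.\<close>
        have "- cut p0 (inv x) \<le> q x" if "q \<in> C" for q
          using sublinear_ge_neg_inv[of q x] that CA True
          unfolding A_def by (smt (verit) mem_Collect_eq subsetD)
        then show ?thesis
          by (intro bdd_belowI[of _ "- cut p0 (inv x)"]) auto
      next
        case False
        then have "q x = 0" if "q \<in> C" for q
          using that CA unfolding A_def by auto
        then show ?thesis
          by (intro bdd_belowI[of _ 0]) force
      qed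
      have u_le: "u x \<le> q x" if "q \<in> C" for q x
        unfolding u_def by (rule cINF_lower[OF bdd that])
      have "sublinear G u"
        unfolding u_def
      proof (rule sublinear_Inf_chain[OF False])
        show "sublinear G q" if "q \<in> C" for q
          using that CA by (auto simp: A_def)
      qed (use chain bdd in auto)
      moreover have "u x \<le> cut p0 x" for x
        using False CA u_le unfolding A_def by (smt (verit) all_not_in_conv mem_Collect_eq subsetD)
      moreover have "u x = 0" if "x \<notin> carrier G" for x
      proof -
        have "(INF q\<in>C. q x) = (INF q\<in>C. 0)"
          using that CA by (intro INF_cong) (auto simp: A_def)
        then show ?thesis
          using False by (simp add: u_def)
      qed
      ultimately have "u \<in> A"
        by (simp add: A_def)
      then show ?thesis
        using u_le unfolding P_def by blast
    qed
  qed
  then obtain m where m: "m \<in> A" and min: "\<And>q. q \<in> A \<Longrightarrow> (\<And>x. q x \<le> m x) \<Longrightarrow> q = m"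
    unfolding P_def by blast
  have sl: "sublinear G m" and m_le: "\<And>x. m x \<le> cut p0 x" and m0: "\<And>x. x \<notin> carrier G \<Longrightarrow> m x = 0"
    using m by (auto simp: A_def)
  have neg: "m (inv w) \<le> - m w" if w: "w \<in> carrier G" for w
  proof -
    obtain s where s: "sublinear G s" "\<And>v. v \<in> carrier G \<Longrightarrow> s v \<le> m v" "s (inv w) \<le> - m w"
      using sublinear_shift[OF sl w] by blast
    have le: "cut s x \<le> m x" for x
      using s(2)[of x] m0[of x] by (simp add: cut_def)
    have "cut s x \<le> cut p0 x" for x
      using le[of x] m_le[of x] by linarith
    then have "cut s \<in> A"
      using cut_sl[OF s(1)] by (simp add: A_def cut_def)
    then have "cut s = m"
      using le by (rule min)
    then have "m (inv w) = s (inv w)"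
      using w by (metis cut_def inv_closed)
    then show ?thesis
      using s(3) by simp
  qed
  have "real_homomorphism G m"
    unfolding real_homomorphism_def
  proof (intro ballI)
    fix x y assume xy: "x \<in> carrier G" "y \<in> carrier G"
    have "m x \<le> m (x \<otimes> y) + m (inv y)"
      using sublinear_mult[OF sl, of "x \<otimes> y" "inv y"] xy by (simp add: m_assoc)
    then show "m (x \<otimes> y) = m x + m y"
      using neg[of y] sublinear_mult[OF sl xy] xy by simp
  qed
  moreover have "m x \<le> p x" if "x \<in> carrier G" for x
    using m_le[of x] p0(2)[OF that] that by (simp add: cut_def)
  moreover have "p x0 \<le> m x0"
  proof -
    have "m (inv x0) \<le> - p x0"
      using m_le[of "inv x0"] p0(3) x0 by (simp add: cut_def)
    then show ?thesis
      using sublinear_ge_neg_inv[OF sl x0] by simp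
  qed
  ultimately show thesis
    by (rule that)
qed

lemma abelian_subadditive_dominates_homomorphism:
  assumes "abelian_subadditive G p" "\<forall>x \<in> carrier G. 0 \<le> p x" "p \<one> = 0"
    and "x0 \<in> carrier G" "\<forall>n::nat. c * real n \<le> p (x0 [^] n)"
  obtains \<phi> where "real_homomorphism G \<phi>" "\<And>x. x \<in> carrier G \<Longrightarrow> \<phi> x \<le> p x" "c \<le> \<phi> x0"
proof -
  obtain q where q: "sublinear G q" "\<And>x. x \<in> carrier G \<Longrightarrow> q x \<le> p x"
      "\<And>x c. x \<in> carrier G \<Longrightarrow> \<forall>n::nat. c * real n \<le> p (x [^] n) \<Longrightarrow> c \<le> q x"
    using sublinear_homogenization[OF assms(1-3)] by blast
  obtain \<phi> where "real_homomorphism G \<phi>" "\<And>x. x \<in> carrier G \<Longrightarrow> \<phi> x \<le> q x" "q x0 \<le> \<phi> x0"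
    using sublinear_dominates_homomorphism[OF q(1) \<open>x0 \<in> carrier G\<close>] by blast
  then show thesis
    using that[of \<phi>] q(2) q(3)[OF assms(4,5)] by force
qed

end

section \<open>Invariant norms and commutators\<close>

context group
begin

lemma inv_cancel_left [simp]:
  "a \<in> carrier G \<Longrightarrow> b \<in> carrier G \<Longrightarrow> inv a \<otimes> (a \<otimes> b) = b"
  "a \<in> carrier G \<Longrightarrow> b \<in> carrier G \<Longrightarrow> a \<otimes> (inv a \<otimes> b) = b"
  by (simp_all add: m_assoc[symmetric])

abbreviation commutator :: "'a \<Rightarrow> 'a \<Rightarrow> 'a"
  where "commutator x y \<equiv> x \<otimes> y \<otimes> inv x \<otimes> inv y"

end

locale normed_group = group +
  fixes \<nu> :: "'a \<Rightarrow> real"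
  assumes norm: "conj_invariant_norm G \<nu>"
begin

lemma norm_nonneg: "x \<in> carrier G \<Longrightarrow> 0 \<le> \<nu> x"
  and norm_one: "\<nu> \<one> = 0"
  and norm_inv: "x \<in> carrier G \<Longrightarrow> \<nu> (inv x) = \<nu> x"
  and norm_mult: "x \<in> carrier G \<Longrightarrow> y \<in> carrier G \<Longrightarrow> \<nu> (x \<otimes> y) \<le> \<nu> x + \<nu> y"
  and norm_conj: "x \<in> carrier G \<Longrightarrow> y \<in> carrier G \<Longrightarrow> \<nu> (y \<otimes> x \<otimes> inv y) = \<nu> x"
  using norm by (auto simp: conj_invariant_norm_def)

lemma norm_nat_pow: "x \<in> carrier G \<Longrightarrow> \<nu> (x [^] (n::nat)) \<le> real n * \<nu> x"
proof (induction n)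
  case (Suc n)
  then show ?case
    using norm_mult[of "x [^] n" x] by (simp add: algebra_simps)
qed (simp add: norm_one)

lemma norm_commutator_swap:
  assumes "x \<in> carrier G" "y \<in> carrier G"
  shows "\<nu> (commutator x y) = \<nu> (commutator y x)"
  using norm_inv[of "commutator x y"] assms by (simp add: inv_mult_group m_assoc)

text \<open>From $[xy, z] = x [y, z] x^{-1} \cdot [x, z]$.\<close>

lemma norm_commutator_mult:
  assumes "x \<in> carrier G" "y \<in> carrier G" "z \<in> carrier G"
  shows "\<nu> (commutator (x \<otimes> y) z) \<le> \<nu> (commutator x z) + \<nu> (commutator y z)"
proof -
  have "commutator (x \<otimes> y) z = (x \<otimes> commutator y z \<otimes> inv x) \<otimes> commutator x z"
    using assms by (simp add: inv_mult_group m_assoc)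
  then show ?thesis
    using norm_mult[of "x \<otimes> commutator y z \<otimes> inv x" "commutator x z"]
      norm_conj[of "commutator y z" x] assms by simp
qed

lemma norm_commutator_mult3:
  assumes uvw: "u \<in> carrier G" "v \<in> carrier G" "w \<in> carrier G" and y: "y \<in> carrier G"
    and "\<nu> (commutator u y) \<le> B" "\<nu> (commutator v y) \<le> B" "\<nu> (commutator w y) \<le> B"
  shows "\<nu> (commutator (u \<otimes> v \<otimes> w) y) \<le> 3 * B"
  using norm_commutator_mult[OF m_closed[OF uvw(1,2)] uvw(3) y]
    norm_commutator_mult[OF uvw(1,2) y] assms(5-7) by linarith

lemma norm_commutator_le:
  assumes "x \<in> carrier G" "y \<in> carrier G"
  shows "\<nu> (commutator x y) \<le> 2 * \<nu> y"
  using norm_mult[of "x \<otimes> y \<otimes> inv x" "inv y"] norm_conj[of y x] norm_inv[of y] assms by simp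

text \<open>If \<open>c = t x t\<inverse>\<close> commutes with \<open>y\<close>, then \<open>x\<close> may be replaced by $x c^{-1} = [x, t]$ in the
  commutator with \<open>y\<close>, and $[x, t]$ is already short.\<close>

lemma norm_commutator_displaced:
  assumes x: "x \<in> carrier G" and y: "y \<in> carrier G" and t: "t \<in> carrier G"
    and commute: "(t \<otimes> x \<otimes> inv t) \<otimes> y = y \<otimes> (t \<otimes> x \<otimes> inv t)"
  shows "\<nu> (commutator x y) \<le> 4 * \<nu> t"
proof -
  define c where "c = t \<otimes> x \<otimes> inv t"
  have c: "c \<in> carrier G" and cy: "c \<otimes> y = y \<otimes> c"
    using assms by (auto simp: c_def)
  have u: "commutator x t = x \<otimes> inv c"
    using x t by (simp add: c_def inv_mult_group m_assoc)
  have "inv c \<otimes> y \<otimes> c = y"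
    using c y by (simp add: m_assoc cy[symmetric])
  then have "inv c \<otimes> (y \<otimes> (c \<otimes> v)) = y \<otimes> v" if "v \<in> carrier G" for v
    using that c y by (simp add: m_assoc[symmetric])
  then have "commutator (x \<otimes> inv c) y = commutator x y"
    using x y c by (simp add: inv_mult_group m_assoc)
  then have "\<nu> (commutator x y) = \<nu> (commutator y (commutator x t))"
    using norm_commutator_swap[of "x \<otimes> inv c" y] x y c u by simp
  also have "\<dots> \<le> 2 * \<nu> (commutator x t)"
    using x y t by (intro norm_commutator_le) auto
  also have "\<dots> \<le> 2 * (2 * \<nu> t)"
    using x t by (intro mult_left_mono norm_commutator_le) auto
  finally show ?thesis
    by simp
qed

text \<open>Fekete's argument: a single \<open>m\<close> with $\nu(f^m) < \varepsilon m$ bounds $\nu(f^n)$ by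
  $\varepsilon n + O(1)$ for all \<open>n\<close>, so without a linear lower bound the stabilization is the limit
  of $\nu(f^n)/n$ and equals zero.\<close>

lemma linear_growth_of_stabilization:
  assumes f: "f \<in> carrier G" and stab: "stabilization G \<nu> f \<noteq> 0"
  shows "\<exists>c>0. \<forall>n::nat. c * real n \<le> \<nu> (f [^] n)"
proof (rule ccontr)
  assume contra: "\<not> ?thesis"
  have "(\<lambda>n. \<nu> (f [^] n) / real n) \<longlonglongrightarrow> 0"
  proof (rule LIMSEQ_I)
    fix e :: real assume "0 < e"
    then obtain m :: nat where m: "\<nu> (f [^] m) < e / 2 * real m"
      using contra \<open>0 < e\<close> by (meson half_gt_zero not_le)
    have "0 < m"
      using m norm_one by (cases m) auto
    obtain N :: nat where N: "real m * \<nu> f < e / 2 * real N"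
      using reals_Archimedean3[of "e / 2"] \<open>0 < e\<close> by (metis half_gt_zero mult.commute)
    have "norm (\<nu> (f [^] n) / real n - 0) < e" if n: "N < n" for n
    proof -
      have "f [^] n = (f [^] m) [^] (n div m) \<otimes> f [^] (n mod m)"
        using f by (simp add: nat_pow_pow nat_pow_mult)
      then have "\<nu> (f [^] n) \<le> \<nu> ((f [^] m) [^] (n div m)) + \<nu> (f [^] (n mod m))"
        using norm_mult f by simp
      also have "\<dots> \<le> real (n div m) * \<nu> (f [^] m) + real (n mod m) * \<nu> f"
        using f by (intro add_mono norm_nat_pow) auto
      also have "real (n mod m) * \<nu> f \<le> real m * \<nu> f"
        using \<open>0 < m\<close> norm_nonneg[OF f] by (intro mult_right_mono) (auto intro: less_imp_le)
      also have "\<dots> < e / 2 * real n"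
        using N n \<open>0 < e\<close> by (smt (verit) half_gt_zero mult_left_mono of_nat_less_iff)
      also have "real (n div m) * \<nu> (f [^] m) \<le> real (n div m) * (e / 2 * real m)"
        using m by (intro mult_left_mono) auto
      also have "\<dots> = e / 2 * real (m * (n div m))"
        by simp
      also have "\<dots> \<le> e / 2 * real n"
        using \<open>0 < e\<close> by (intro mult_left_mono of_nat_mono) auto
      finally have "\<nu> (f [^] n) < e * real n"
        by simp
      then show ?thesis
        using n norm_nonneg[of "f [^] n"] f by (simp add: pos_divide_less_eq)
    qed
    then show "\<exists>N. \<forall>n\<ge>N. norm (\<nu> (f [^] n) / real n - 0) < e"
      by (intro exI[of _ "Suc N"]) auto
  qed
  then show False
    using stab by (simp add: stabilization_def limI)
qed

end

section \<open>The asymptotic group of a norm with bounded commutators\<close>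

definition linear_bound :: "('a \<Rightarrow> real) \<Rightarrow> (nat \<Rightarrow> 'a) \<Rightarrow> real \<Rightarrow> bool"
  where "linear_bound \<nu> x C \<longleftrightarrow> 0 \<le> C \<and> (\<exists>D. \<forall>n. \<nu> (x n) \<le> C * real n + D)"

definition sequence_group :: "('a, 'b) monoid_scheme \<Rightarrow> ('a \<Rightarrow> real) \<Rightarrow> (nat \<Rightarrow> 'a) monoid"
  where
  "sequence_group G \<nu> =
     \<lparr>carrier = {x. (\<forall>n. x n \<in> carrier G) \<and> (\<exists>C. linear_bound \<nu> x C)},
      monoid.mult = (\<lambda>x y n. x n \<otimes>\<^bsub>G\<^esub> y n),
      one = (\<lambda>n. \<one>\<^bsub>G\<^esub>)\<rparr>"

text \<open>For a nonnegative \<open>\<nu>\<close> this is $\limsup \nu(x_n)/n$; the form with slopes absorbs bounded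
  perturbations of $\nu(x_n)$ into the additive constant.\<close>

definition growth_rate :: "('a \<Rightarrow> real) \<Rightarrow> (nat \<Rightarrow> 'a) \<Rightarrow> real"
  where "growth_rate \<nu> x = Inf {C. linear_bound \<nu> x C}"

lemma growth_rate_le: "linear_bound \<nu> x C \<Longrightarrow> growth_rate \<nu> x \<le> C"
  unfolding growth_rate_def
  by (rule cInf_lower) (auto simp: linear_bound_def intro!: bdd_belowI[of _ 0])

lemma growth_rate_ge:
  "linear_bound \<nu> x C \<Longrightarrow> (\<And>C. linear_bound \<nu> x C \<Longrightarrow> c \<le> C) \<Longrightarrow> c \<le> growth_rate \<nu> x"
  unfolding growth_rate_def by (rule cInf_greatest) auto

lemma linear_bound_lower:
  assumes "linear_bound \<nu> x C" and c: "\<And>n. c * real n \<le> \<nu> (x n)"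
  shows "c \<le> C"
proof (rule ccontr)
  assume "\<not> c \<le> C"
  obtain D where D: "\<And>n. \<nu> (x n) \<le> C * real n + D"
    using assms by (auto simp: linear_bound_def)
  obtain n :: nat where "D < real n * (c - C)"
    using reals_Archimedean3[of "c - C"] \<open>\<not> c \<le> C\<close> by auto
  then show False
    using D[of n] c[of n] by (simp add: algebra_simps)
qed

context normed_group
begin

lemma linear_bound_mult:
  assumes "\<And>n. x n \<in> carrier G" "\<And>n. y n \<in> carrier G"
    and "linear_bound \<nu> x C" "linear_bound \<nu> y C'"
  shows "linear_bound \<nu> (\<lambda>n. x n \<otimes> y n) (C + C')"
proof -
  obtain D D' where "\<And>n. \<nu> (x n) \<le> C * real n + D" "\<And>n. \<nu> (y n) \<le> C' * real n + D'"
    using assms by (auto simp: linear_bound_def)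
  then have "\<nu> (x n \<otimes> y n) \<le> (C + C') * real n + (D + D')" for n
    using norm_mult[of "x n" "y n"] assms(1,2) by (smt (verit) distrib_right)
  then show ?thesis
    using assms by (auto simp: linear_bound_def)
qed

lemma linear_bound_inv:
  "(\<And>n. x n \<in> carrier G) \<Longrightarrow> linear_bound \<nu> (\<lambda>n. inv (x n)) C \<longleftrightarrow> linear_bound \<nu> x C"
  by (simp add: linear_bound_def norm_inv)

lemma linear_bound_power: "g \<in> carrier G \<Longrightarrow> linear_bound \<nu> (\<lambda>n. g [^] n) (\<nu> g)"
  using norm_nat_pow[of g] norm_nonneg[of g]
  by (auto simp: linear_bound_def mult.commute intro!: exI[of _ 0])

lemma carrier_sequence_group:
  "x \<in> carrier (sequence_group G \<nu>) \<longleftrightarrow> (\<forall>n. x n \<in> carrier G) \<and> (\<exists>C. linear_bound \<nu> x C)"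
  by (simp add: sequence_group_def)

lemma mult_sequence_group: "x \<otimes>\<^bsub>sequence_group G \<nu>\<^esub> y = (\<lambda>n. x n \<otimes> y n)"
  by (simp add: sequence_group_def)

lemma one_sequence_group: "\<one>\<^bsub>sequence_group G \<nu>\<^esub> = (\<lambda>n. \<one>)"
  by (simp add: sequence_group_def)

lemma linear_bound_one: "linear_bound \<nu> (\<lambda>n. \<one>) 0"
  by (auto simp: linear_bound_def norm_one)

lemma group_sequence_group: "group (sequence_group G \<nu>)"
proof (rule groupI)
  fix x assume x: "x \<in> carrier (sequence_group G \<nu>)"
  show "\<exists>y\<in>carrier (sequence_group G \<nu>). y \<otimes>\<^bsub>sequence_group G \<nu>\<^esub> x = \<one>\<^bsub>sequence_group G \<nu>\<^esub>"
    by (rule bexI[of _ "\<lambda>n. inv (x n)"])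
      (use x in \<open>auto simp: carrier_sequence_group mult_sequence_group one_sequence_group linear_bound_inv\<close>)
next
  fix x y
  assume "x \<in> carrier (sequence_group G \<nu>)" "y \<in> carrier (sequence_group G \<nu>)"
  then show "x \<otimes>\<^bsub>sequence_group G \<nu>\<^esub> y \<in> carrier (sequence_group G \<nu>)"
    by (auto simp: carrier_sequence_group mult_sequence_group intro: linear_bound_mult)
qed (auto simp: carrier_sequence_group mult_sequence_group one_sequence_group m_assoc
    intro: linear_bound_one)

lemma inv_sequence_group:
  assumes "x \<in> carrier (sequence_group G \<nu>)"
  shows "inv\<^bsub>sequence_group G \<nu>\<^esub> x = (\<lambda>n. inv (x n))"
proof -
  interpret H: group "sequence_group G \<nu>"
    by (rule group_sequence_group)
  show ?thesis
    by (rule H.inv_equality)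
      (use assms in \<open>auto simp: carrier_sequence_group mult_sequence_group one_sequence_group linear_bound_inv\<close>)
qed

lemma pow_sequence_group: "x [^]\<^bsub>sequence_group G \<nu>\<^esub> (k::nat) = (\<lambda>n. x n [^] k)"
  by (induction k) (simp_all add: one_sequence_group mult_sequence_group)

lemma growth_rate_mult:
  assumes "x \<in> carrier (sequence_group G \<nu>)" "y \<in> carrier (sequence_group G \<nu>)"
  shows "growth_rate \<nu> (x \<otimes>\<^bsub>sequence_group G \<nu>\<^esub> y) \<le> growth_rate \<nu> x + growth_rate \<nu> y"
proof -
  have x: "\<And>n. x n \<in> carrier G" and y: "\<And>n. y n \<in> carrier G"
    using assms by (auto simp: carrier_sequence_group)
  obtain C0 C0' where C0: "linear_bound \<nu> x C0" and C0': "linear_bound \<nu> y C0'"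
    using assms by (auto simp: carrier_sequence_group)
  have *: "growth_rate \<nu> (\<lambda>n. x n \<otimes> y n) \<le> C + C'"
    if "linear_bound \<nu> x C" "linear_bound \<nu> y C'" for C C'
    using that by (intro growth_rate_le linear_bound_mult x y)
  have "growth_rate \<nu> (\<lambda>n. x n \<otimes> y n) - C' \<le> growth_rate \<nu> x" if "linear_bound \<nu> y C'" for C'
    using *[OF _ that] by (intro growth_rate_ge[OF C0]) (simp add: algebra_simps)
  then have "growth_rate \<nu> (\<lambda>n. x n \<otimes> y n) - growth_rate \<nu> x \<le> growth_rate \<nu> y"
    by (intro growth_rate_ge[OF C0']) (simp add: algebra_simps)
  then show ?thesis
    by (simp add: mult_sequence_group)
qed

end

locale bounded_commutators = normed_group +
  fixes K :: real
  assumes norm_commutator_bound: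
    "x \<in> carrier G \<Longrightarrow> y \<in> carrier G \<Longrightarrow> \<nu> (commutator x y) \<le> K"
begin

lemma bound_nonneg: "0 \<le> K"
  using norm_commutator_bound[of \<one> \<one>] by (simp add: norm_one)

text \<open>Exchanging two entries changes the norm of the \<open>n\<close>-th term by at most \<open>K\<close>, which is
  absorbed by the additive constant of the linear bound.\<close>

lemma linear_bound_swap:
  assumes "\<And>n. x n \<in> carrier G" "\<And>n. y n \<in> carrier G" "\<And>n. z n \<in> carrier G"
    and "linear_bound \<nu> (\<lambda>n. x n \<otimes> y n \<otimes> z n) C"
  shows "linear_bound \<nu> (\<lambda>n. y n \<otimes> x n \<otimes> z n) C"
proof -
  obtain D where D: "\<And>n. \<nu> (x n \<otimes> y n \<otimes> z n) \<le> C * real n + D"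
    using assms by (auto simp: linear_bound_def)
  have "\<nu> (y n \<otimes> x n \<otimes> z n) \<le> C * real n + (D + K)" for n
  proof -
    have "y n \<otimes> x n \<otimes> z n = commutator (y n) (x n) \<otimes> (x n \<otimes> y n \<otimes> z n)"
      using assms(1-3) by (simp add: m_assoc)
    then have "\<nu> (y n \<otimes> x n \<otimes> z n) \<le> \<nu> (commutator (y n) (x n)) + \<nu> (x n \<otimes> y n \<otimes> z n)"
      using norm_mult[of "commutator (y n) (x n)" "x n \<otimes> y n \<otimes> z n"] assms(1-3) by simp
    then show ?thesis
      using D[of n] norm_commutator_bound[of "y n" "x n"] assms(1-3) by simp
  qed
  then show ?thesis
    using assms(4) by (auto simp: linear_bound_def)
qed

lemma abelian_subadditive_growth_rate: "abelian_subadditive (sequence_group G \<nu>) (growth_rate \<nu>)"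
  unfolding abelian_subadditive_def
proof (intro conjI ballI)
  fix x y z
  assume "x \<in> carrier (sequence_group G \<nu>)" "y \<in> carrier (sequence_group G \<nu>)"
    "z \<in> carrier (sequence_group G \<nu>)"
  then have "linear_bound \<nu> (\<lambda>n. x n \<otimes> y n \<otimes> z n) C \<longleftrightarrow> linear_bound \<nu> (\<lambda>n. y n \<otimes> x n \<otimes> z n) C" for C
    using linear_bound_swap[of x y z C] linear_bound_swap[of y x z C]
    by (auto simp: carrier_sequence_group)
  then show "growth_rate \<nu> (x \<otimes>\<^bsub>sequence_group G \<nu>\<^esub> y \<otimes>\<^bsub>sequence_group G \<nu>\<^esub> z)
      = growth_rate \<nu> (y \<otimes>\<^bsub>sequence_group G \<nu>\<^esub> x \<otimes>\<^bsub>sequence_group G \<nu>\<^esub> z)"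
    by (simp add: growth_rate_def mult_sequence_group)
qed (rule growth_rate_mult)

text \<open>Passing from \<open>n\<close> to \<open>n + 1\<close> moves one \<open>g\<close> across $h^n$, which inserts a conjugate of the single
  commutator $[g, h^n]$.\<close>

lemma norm_power_mult_defect:
  assumes "g \<in> carrier G" "h \<in> carrier G"
  shows "\<nu> (g [^] n \<otimes> h [^] n \<otimes> inv ((g \<otimes> h) [^] n)) \<le> K * real n"
proof (induction n)
  case (Suc n)
  define P Q R where "P = g [^] n" and "Q = h [^] n" and "R = (g \<otimes> h) [^] n"
  have [simp]: "P \<in> carrier G" "Q \<in> carrier G" "R \<in> carrier G"
    using assms by (auto simp: P_def Q_def R_def)
  have "P \<otimes> g \<otimes> (Q \<otimes> h) \<otimes> inv (R \<otimes> (g \<otimes> h))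
      = (P \<otimes> commutator g Q \<otimes> inv P) \<otimes> (P \<otimes> Q \<otimes> inv R)"
    using assms by (simp add: inv_mult_group m_assoc)
  then have "\<nu> (P \<otimes> g \<otimes> (Q \<otimes> h) \<otimes> inv (R \<otimes> (g \<otimes> h))) \<le> \<nu> (commutator g Q) + \<nu> (P \<otimes> Q \<otimes> inv R)"
    using norm_mult[of "P \<otimes> commutator g Q \<otimes> inv P" "P \<otimes> Q \<otimes> inv R"]
      norm_conj[of "commutator g Q" P] assms by simp
  then show ?case
    using norm_commutator_bound[of g Q] Suc assms
    by (simp add: P_def Q_def R_def algebra_simps)
qed (simp add: norm_one)

text \<open>The sequence of powers of \<open>g\<close> depends on \<open>g\<close> homogeneously, term by term, so composing it with
  a homomorphism gives a function that is homogeneous without any averaging. It is additive up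
  to the growth rate of $g^n h^n (gh)^{-n}$.\<close>

theorem homogeneous_quasimorphism_of_linear_growth:
  assumes f: "f \<in> carrier G" and c: "\<forall>n::nat. c * real n \<le> \<nu> (f [^] n)"
  obtains r where "quasi_morphism G r" "homogeneous G r" "c \<le> r f"
proof -
  let ?H = "sequence_group G \<nu>"
  interpret H: group ?H
    by (rule group_sequence_group)
  define \<alpha> where "\<alpha> g = (\<lambda>n::nat. g [^] n)" for g
  have \<alpha>: "\<alpha> g \<in> carrier ?H" if "g \<in> carrier G" for g
    using that linear_bound_power[OF that] by (auto simp: \<alpha>_def carrier_sequence_group)
  have nonneg: "\<forall>x \<in> carrier ?H. 0 \<le> growth_rate \<nu> x"
  proof
    fix x assume "x \<in> carrier ?H"
    then obtain C where "linear_bound \<nu> x C"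
      by (auto simp: carrier_sequence_group)
    then show "0 \<le> growth_rate \<nu> x"
      by (rule growth_rate_ge) (simp add: linear_bound_def)
  qed
  have one: "growth_rate \<nu> \<one>\<^bsub>?H\<^esub> = 0"
    using growth_rate_le[OF linear_bound_one] nonneg H.one_closed
    by (force simp: one_sequence_group)
  have "\<forall>k::nat. c * real k \<le> growth_rate \<nu> (\<alpha> f [^]\<^bsub>?H\<^esub> k)"
  proof
    fix k :: nat
    have "\<alpha> f [^]\<^bsub>?H\<^esub> k \<in> carrier ?H"
      using \<alpha>[OF f] by simp
    then obtain C where C: "linear_bound \<nu> (\<alpha> f [^]\<^bsub>?H\<^esub> k) C"
      by (auto simp: carrier_sequence_group)
    have "c * real k * real n \<le> \<nu> ((\<alpha> f [^]\<^bsub>?H\<^esub> k) n)" for n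
      using c[rule_format, of "n * k"] f
      by (simp add: pow_sequence_group \<alpha>_def nat_pow_pow mult_ac)
    then have "c * real k \<le> C'" if "linear_bound \<nu> (\<alpha> f [^]\<^bsub>?H\<^esub> k) C'" for C'
      by (rule linear_bound_lower[OF that])
    then show "c * real k \<le> growth_rate \<nu> (\<alpha> f [^]\<^bsub>?H\<^esub> k)"
      by (rule growth_rate_ge[OF C])
  qed
  note lower = this
  obtain \<phi> where \<phi>: "real_homomorphism ?H \<phi>"
      and le: "\<And>x. x \<in> carrier ?H \<Longrightarrow> \<phi> x \<le> growth_rate \<nu> x" and "c \<le> \<phi> (\<alpha> f)"
    using H.abelian_subadditive_dominates_homomorphism
        [OF abelian_subadditive_growth_rate nonneg one \<alpha>[OF f] lower] by metis
  \<comment> \<open>The defect is at most \<open>K\<close>; the summand 1 makes the constant strictly positive.\<close>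
  have "\<bar>\<phi> (\<alpha> (a \<otimes> b)) - \<phi> (\<alpha> a) - \<phi> (\<alpha> b)\<bar> \<le> K + 1"
    if ab: "a \<in> carrier G" "b \<in> carrier G" for a b
  proof -
    define d where "d = \<alpha> a \<otimes>\<^bsub>?H\<^esub> \<alpha> b \<otimes>\<^bsub>?H\<^esub> inv\<^bsub>?H\<^esub> \<alpha> (a \<otimes> b)"
    have d: "d \<in> carrier ?H"
      using ab \<alpha> by (simp add: d_def)
    have d_n: "d n = a [^] n \<otimes> b [^] n \<otimes> inv ((a \<otimes> b) [^] n)" for n
      using ab \<alpha> by (simp add: d_def mult_sequence_group inv_sequence_group) (simp add: \<alpha>_def)
    have bound: "linear_bound \<nu> d K"
      using norm_power_mult_defect[OF ab] bound_nonneg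
      unfolding linear_bound_def d_n by (intro conjI exI[of _ 0]) auto
    have "linear_bound \<nu> (inv\<^bsub>?H\<^esub> d) K"
      using bound d by (simp add: inv_sequence_group linear_bound_inv carrier_sequence_group)
    then have "\<phi> d \<le> K" "- \<phi> d \<le> K"
      using le[OF d] le[of "inv\<^bsub>?H\<^esub> d"] growth_rate_le[OF bound] growth_rate_le[of \<nu> "inv\<^bsub>?H\<^esub> d" K]
        H.real_homomorphism_inv[OF \<phi> d] d by auto
    moreover have "\<phi> d = \<phi> (\<alpha> a) + \<phi> (\<alpha> b) - \<phi> (\<alpha> (a \<otimes> b))"
      using ab \<alpha> by (simp add: d_def H.real_homomorphism_mult[OF \<phi>] H.real_homomorphism_inv[OF \<phi>])
    ultimately show ?thesis
      by linarith
  qed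
  then have "quasi_morphism G (\<lambda>g. \<phi> (\<alpha> g))"
    unfolding quasi_morphism_def using bound_nonneg by (intro exI[of _ "K + 1"]) auto
  moreover have "homogeneous G (\<lambda>g. \<phi> (\<alpha> g))"
    unfolding homogeneous_def
  proof (intro ballI allI)
    fix a and k :: int assume a: "a \<in> carrier G"
    have pow: "\<phi> (\<alpha> (a [^] m)) = real m * \<phi> (\<alpha> a)" for m :: nat
    proof -
      have "\<alpha> (a [^] m) = \<alpha> a [^]\<^bsub>?H\<^esub> m"
        using a by (simp add: \<alpha>_def pow_sequence_group nat_pow_pow mult.commute)
      then show ?thesis
        using H.real_homomorphism_nat_pow[OF \<phi> \<alpha>[OF a]] by simp
    qed
    have minus: "\<phi> (\<alpha> (inv b)) = - \<phi> (\<alpha> b)" if b: "b \<in> carrier G" for b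
    proof -
      have "\<alpha> (inv b) = inv\<^bsub>?H\<^esub> \<alpha> b"
        using \<alpha>[OF b] b by (simp add: inv_sequence_group) (simp add: \<alpha>_def nat_pow_inv)
      then show ?thesis
        using H.real_homomorphism_inv[OF \<phi> \<alpha>[OF b]] by simp
    qed
    show "\<phi> (\<alpha> (a [^] k)) = real_of_int k * \<phi> (\<alpha> a)"
    proof (cases k)
      case (nonneg m)
      then show ?thesis
        using pow[of m] by (simp add: int_pow_int)
    next
      case (neg m)
      then show ?thesis
        using a pow[of "Suc m"] by (simp add: int_pow_neg_int minus del: of_nat_Suc nat_pow_Suc)
    qed
  qed
  ultimately show thesis
    using \<open>c \<le> \<phi> (\<alpha> f)\<close> by (rule that)
qed

end

section \<open>Finite abelianization\<close>

context group
begin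

lemma real_homomorphism_derived_zero:
  assumes \<psi>: "real_homomorphism G \<psi>" and x: "x \<in> derived G (carrier G)"
  shows "\<psi> x = 0"
proof -
  define N where "N = {x \<in> carrier G. \<psi> x = 0}"
  have "subgroup N G"
    by (rule subgroupI)
      (auto simp: N_def real_homomorphism_one[OF \<psi>] real_homomorphism_inv[OF \<psi>]
        real_homomorphism_mult[OF \<psi>])
  moreover have "derived_set G (carrier G) \<subseteq> N"
    by (auto simp: N_def real_homomorphism_inv[OF \<psi>] real_homomorphism_mult[OF \<psi>])
  ultimately have "derived G (carrier G) \<subseteq> N"
    unfolding derived_def by (intro generate_subgroup_incl)
  then show ?thesis
    using x by (auto simp: N_def)
qed

text \<open>A power $x^n$ with $n > 0$ lies in the derived subgroup, on which \<open>\<psi>\<close> vanishes.\<close>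

lemma real_homomorphism_zero_of_finite_abelianization:
  assumes fin: "finite (carrier (G Mod derived G (carrier G)))"
    and \<psi>: "real_homomorphism G \<psi>" and x: "x \<in> carrier G"
  shows "\<psi> x = 0"
proof -
  interpret D: normal "derived G (carrier G)" G
    by (rule derived_self_is_normal)
  interpret Q: group "G Mod derived G (carrier G)"
    by (rule D.factorgroup_is_group)
  define n where "n = order (G Mod derived G (carrier G))"
  have "0 < n"
    using fin Q.order_gt_0_iff_finite by (simp add: n_def)
  have xQ: "derived G (carrier G) #> x \<in> carrier (G Mod derived G (carrier G))"
    using x by (auto simp: FactGroup_def RCOSETS_def)
  have "derived G (carrier G) #> (x [^] n) = (derived G (carrier G) #> x) [^]\<^bsub>G Mod derived G (carrier G)\<^esub> n"
    using D.FactGroup_int_pow[OF x, of "int n"] by (simp add: int_pow_int)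
  also have "\<dots> = derived G (carrier G)"
    using Q.pow_order_eq_1[OF xQ] by (simp add: n_def)
  finally have "x [^] n \<in> derived G (carrier G)"
    using rcos_self[OF _ D.subgroup_axioms, of "x [^] n"] x by simp
  then have "real n * \<psi> x = 0"
    using real_homomorphism_derived_zero[OF \<psi>] real_homomorphism_nat_pow[OF \<psi> x, of n] by simp
  then show ?thesis
    using \<open>0 < n\<close> by simp
qed

end

section \<open>The swap extension\<close>

lemma swap_extension_cases:
  assumes "group G" "x \<in> carrier (swap_extension G)"
  obtains a b k where "a \<in> carrier G" "b \<in> carrier G" "k = 0 \<or> k = 1"
    "x = ((a, \<one>\<^bsub>G\<^esub>), 0) \<otimes>\<^bsub>swap_extension G\<^esub> ((\<one>\<^bsub>G\<^esub>, b), 0) \<otimes>\<^bsub>swap_extension G\<^esub> ((\<one>\<^bsub>G\<^esub>, \<one>\<^bsub>G\<^esub>), k)"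
proof -
  interpret G: group G by fact
  obtain a b k where "x = ((a, b), k)" "a \<in> carrier G" "b \<in> carrier G" "k = 0 \<or> k = 1"
    using assms(2) by (auto simp: carrier_swap_extension)
  then show thesis
    by (intro that[of a b k]) (auto simp: mult_swap_extension)
qed

text \<open>Commutators are subadditive in each entry, so it suffices to bound those of the factors from
  $G \times 1$, $1 \times G$ and $\{1, t\}$. Two factors from the same copy of \<open>G\<close> are displaced from
  each other by \<open>t\<close>, factors from different copies commute, and a commutator with \<open>t\<close> has norm at
  most $2 \nu(t)$.\<close>

lemma swap_extension_norm_commutator_bound:
  fixes G :: "('a, 'b) monoid_scheme"
  assumes G: "group G" and \<nu>: "conj_invariant_norm (swap_extension G) \<nu>"
  shows "\<exists>K. bounded_commutators (swap_extension G) \<nu> K"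
proof -
  interpret G: group G by (rule G)
  interpret E: group "swap_extension G"
    by (rule group_swap_extension[OF G])
  interpret E: normed_group "swap_extension G" \<nu>
    by unfold_locales (rule \<nu>)
  define t where "t = ((\<one>\<^bsub>G\<^esub>, \<one>\<^bsub>G\<^esub>), 1 :: int)"
  define i j where "i a = ((a, \<one>\<^bsub>G\<^esub>), 0 :: int)" and "j a = ((\<one>\<^bsub>G\<^esub>, a), 0 :: int)" for a :: 'a
  let ?T = "\<lambda>k :: int. ((\<one>\<^bsub>G\<^esub>, \<one>\<^bsub>G\<^esub>), k)"
  have t: "t \<in> carrier (swap_extension G)"
    by (simp add: t_def carrier_swap_extension)
  have i: "i a \<in> carrier (swap_extension G)" and j: "j a \<in> carrier (swap_extension G)"
    if "a \<in> carrier G" for a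
    using that by (simp_all add: i_def j_def carrier_swap_extension)
  have T: "?T k \<in> carrier (swap_extension G)" "\<nu> (?T k) \<le> \<nu> t" if "k = 0 \<or> k = 1" for k
    using that E.norm_nonneg[OF t] E.norm_one by (auto simp: carrier_swap_extension one_swap_extension t_def)
  define \<tau> where "\<tau> = \<nu> t"
  have \<tau>: "0 \<le> \<tau>"
    using E.norm_nonneg[OF t] by (simp add: \<tau>_def)
  have t_i: "t \<otimes>\<^bsub>swap_extension G\<^esub> i a \<otimes>\<^bsub>swap_extension G\<^esub> inv\<^bsub>swap_extension G\<^esub> t = j a"
    and t_j: "t \<otimes>\<^bsub>swap_extension G\<^esub> j a \<otimes>\<^bsub>swap_extension G\<^esub> inv\<^bsub>swap_extension G\<^esub> t = i a"
    if "a \<in> carrier G" for a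
    using swap_extension_conj[OF G that G.one_closed] swap_extension_conj[OF G G.one_closed that]
    by (simp_all add: i_def j_def t_def)
  have ij: "i a \<otimes>\<^bsub>swap_extension G\<^esub> j b = j b \<otimes>\<^bsub>swap_extension G\<^esub> i a"
    if "a \<in> carrier G" "b \<in> carrier G" for a b
    using that by (simp add: i_def j_def mult_swap_extension)
  have ii: "\<nu> (E.commutator (i a) (i b)) \<le> 4 * \<tau>" and jj: "\<nu> (E.commutator (j a) (j b)) \<le> 4 * \<tau>"
    if "a \<in> carrier G" "b \<in> carrier G" for a b
    unfolding \<tau>_def using that i j t ij
    by (intro E.norm_commutator_displaced; simp add: t_i t_j)+
  have comm0: "\<nu> (E.commutator x y) \<le> 4 * \<tau>"
    if "x \<in> carrier (swap_extension G)" "y \<in> carrier (swap_extension G)"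
      "x \<otimes>\<^bsub>swap_extension G\<^esub> y = y \<otimes>\<^bsub>swap_extension G\<^esub> x" for x y
    using that \<tau> by (simp add: E.m_assoc E.norm_one)
  have ij0: "\<nu> (E.commutator (i a) (j b)) \<le> 4 * \<tau>"
    if "a \<in> carrier G" "b \<in> carrier G" for a b
    by (rule comm0[OF i[OF that(1)] j[OF that(2)] ij[OF that]])
  have ji0: "\<nu> (E.commutator (j b) (i a)) \<le> 4 * \<tau>"
    if "a \<in> carrier G" "b \<in> carrier G" for a b
    by (rule comm0[OF j[OF that(2)] i[OF that(1)] ij[OF that, symmetric]])
  define base where "base = i ` carrier G \<union> j ` carrier G"
  define gens where "gens = base \<union> {?T 0, ?T 1}"
  have gens_carrier: "x \<in> carrier (swap_extension G)" if "x \<in> gens" for x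
    using that i j T(1)[of 0] T(1)[of 1] by (auto simp: gens_def base_def)
  have gens: "\<nu> (E.commutator x y) \<le> 4 * \<tau>" if x: "x \<in> gens" and y: "y \<in> gens" for x y
  proof -
    have T': "\<nu> (E.commutator z (?T k)) \<le> 4 * \<tau>" if "z \<in> gens" "k = 0 \<or> k = 1" for z k
      using E.norm_commutator_le[OF gens_carrier[OF that(1)] T(1)[OF that(2)]] T(2)[OF that(2)] \<tau>
      unfolding \<tau>_def by linarith
    have sw: "\<nu> (E.commutator x y) = \<nu> (E.commutator y x)"
      by (intro E.norm_commutator_swap gens_carrier x y)
    have "x \<in> {?T 0, ?T 1} \<or> y \<in> {?T 0, ?T 1} \<or> x \<in> base \<and> y \<in> base"
      using x y unfolding gens_def by blast
    then show ?thesis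
    proof (elim disjE)
      assume "x \<in> {?T 0, ?T 1}"
      then show ?thesis
        unfolding sw using T'[OF y] by blast
    next
      assume "y \<in> {?T 0, ?T 1}"
      then show ?thesis
        using T'[OF x] by blast
    next
      assume "x \<in> base \<and> y \<in> base"
      then obtain a b where ab: "a \<in> carrier G" "b \<in> carrier G"
        and "x = i a \<or> x = j a" "y = i b \<or> y = j b"
        unfolding base_def by blast
      then show ?thesis
        by (elim disjE) (simp_all only: ii jj ij0 ji0 ab)
    qed
  qed
  have decomp: "\<exists>u\<in>gens. \<exists>v\<in>gens. \<exists>w\<in>gens. x = u \<otimes>\<^bsub>swap_extension G\<^esub> v \<otimes>\<^bsub>swap_extension G\<^esub> w"
    if x: "x \<in> carrier (swap_extension G)" for x
  proof -
    obtain a b k where "a \<in> carrier G" "b \<in> carrier G" "k = 0 \<or> k = 1"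
      and "x = i a \<otimes>\<^bsub>swap_extension G\<^esub> j b \<otimes>\<^bsub>swap_extension G\<^esub> ?T k"
      using swap_extension_cases[OF G x] unfolding i_def j_def by blast
    moreover from this have "i a \<in> gens" "j b \<in> gens" "?T k \<in> gens"
      by (auto simp: gens_def base_def)
    ultimately show ?thesis
      by blast
  qed
  have gens_all: "\<nu> (E.commutator x y) \<le> 3 * (4 * \<tau>)"
    if x: "x \<in> carrier (swap_extension G)" and y: "y \<in> gens" for x y
  proof -
    obtain u v w where uvw: "u \<in> gens" "v \<in> gens" "w \<in> gens"
      and x_eq: "x = u \<otimes>\<^bsub>swap_extension G\<^esub> v \<otimes>\<^bsub>swap_extension G\<^esub> w"
      using decomp[OF x] by blast
    show ?thesis
      unfolding x_eq by (intro E.norm_commutator_mult3 gens gens_carrier uvw y)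
  qed
  have "\<nu> (E.commutator y x) \<le> 3 * (3 * (4 * \<tau>))"
    if x: "x \<in> carrier (swap_extension G)" and y: "y \<in> carrier (swap_extension G)" for x y
  proof -
    obtain u v w where uvw: "u \<in> gens" "v \<in> gens" "w \<in> gens"
      and y_eq: "y = u \<otimes>\<^bsub>swap_extension G\<^esub> v \<otimes>\<^bsub>swap_extension G\<^esub> w"
      using decomp[OF y] by blast
    have gens_x: "\<nu> (E.commutator z x) \<le> 3 * (4 * \<tau>)" if "z \<in> gens" for z
      using gens_all[OF x that] unfolding E.norm_commutator_swap[OF x gens_carrier[OF that]] .
    show ?thesis
      unfolding y_eq by (intro E.norm_commutator_mult3 gens_carrier uvw gens_x x)
  qed
  then show ?thesis
    by (intro exI[of _ "3 * (3 * (4 * \<tau>))"]) unfold_locales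
qed

lemma swap_extension_real_homomorphism_zero:
  assumes G: "group G" and fin: "finite (carrier (G Mod derived G (carrier G)))"
    and r: "real_homomorphism (swap_extension G) r" and x: "x \<in> carrier (swap_extension G)"
  shows "r x = 0"
proof -
  interpret G: group G by (rule G)
  interpret E: group "swap_extension G"
    by (rule group_swap_extension[OF G])
  note mult = E.real_homomorphism_mult[OF r]
  obtain a b k where ab: "a \<in> carrier G" "b \<in> carrier G" and k: "k = 0 \<or> k = 1"
    and x_eq: "x = ((a, \<one>\<^bsub>G\<^esub>), 0) \<otimes>\<^bsub>swap_extension G\<^esub> ((\<one>\<^bsub>G\<^esub>, b), 0) \<otimes>\<^bsub>swap_extension G\<^esub> ((\<one>\<^bsub>G\<^esub>, \<one>\<^bsub>G\<^esub>), k)"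
    using swap_extension_cases[OF G x] .
  have "real_homomorphism G (\<lambda>g. r ((g, \<one>\<^bsub>G\<^esub>), 0))" "real_homomorphism G (\<lambda>g. r ((\<one>\<^bsub>G\<^esub>, g), 0))"
    using mult[of "((g, \<one>\<^bsub>G\<^esub>), 0)" "((h, \<one>\<^bsub>G\<^esub>), 0)" for g h] mult[of "((\<one>\<^bsub>G\<^esub>, g), 0)" "((\<one>\<^bsub>G\<^esub>, h), 0)" for g h]
    by (simp_all add: real_homomorphism_def carrier_swap_extension mult_swap_extension)
  then have "r ((a, \<one>\<^bsub>G\<^esub>), 0) = 0" "r ((\<one>\<^bsub>G\<^esub>, b), 0) = 0"
    using G.real_homomorphism_zero_of_finite_abelianization[OF fin] ab by blast+
  moreover have "r ((\<one>\<^bsub>G\<^esub>, \<one>\<^bsub>G\<^esub>), k) = 0"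
  proof -
    have "r ((\<one>\<^bsub>G\<^esub>, \<one>\<^bsub>G\<^esub>), 1) + r ((\<one>\<^bsub>G\<^esub>, \<one>\<^bsub>G\<^esub>), 1) = 0"
      using mult[of "((\<one>\<^bsub>G\<^esub>, \<one>\<^bsub>G\<^esub>), 1)" "((\<one>\<^bsub>G\<^esub>, \<one>\<^bsub>G\<^esub>), 1)"] swap_extension_involution[OF G]
        E.real_homomorphism_one[OF r]
      by (simp add: carrier_swap_extension)
    then show ?thesis
      using k E.real_homomorphism_one[OF r] by (auto simp: one_swap_extension)
  qed
  moreover have mem: "((a, \<one>\<^bsub>G\<^esub>), 0) \<in> carrier (swap_extension G)"
      "((\<one>\<^bsub>G\<^esub>, b), 0) \<in> carrier (swap_extension G)"
      "((\<one>\<^bsub>G\<^esub>, \<one>\<^bsub>G\<^esub>), k) \<in> carrier (swap_extension G)"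
    using ab k by (auto simp: carrier_swap_extension)
  ultimately show ?thesis
    unfolding x_eq mult[OF E.m_closed[OF mem(1,2)] mem(3)] mult[OF mem(1,2)] by linarith
qed

theorem proposition1p8:
  fixes G :: "('a, 'b) monoid_scheme"
  assumes "group G"
    and "finite (carrier (G Mod derived G (carrier G)))"
    and "\<exists>\<nu>. stably_unbounded_norm (swap_extension G) \<nu>"
  shows "\<exists>r. quasi_morphism (swap_extension G) r \<and> homogeneous (swap_extension G) r \<and>
             \<not> real_homomorphism (swap_extension G) r"
proof -
  obtain \<nu> f where \<nu>: "conj_invariant_norm (swap_extension G) \<nu>"
    and f: "f \<in> carrier (swap_extension G)" and stab: "stabilization (swap_extension G) \<nu> f \<noteq> 0"
    using assms(3) by (auto simp: stably_unbounded_norm_def)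
  obtain K where "bounded_commutators (swap_extension G) \<nu> K"
    using swap_extension_norm_commutator_bound[OF assms(1) \<nu>] by blast
  then interpret bounded_commutators "swap_extension G" \<nu> K .
  obtain c where "0 < c" and c: "\<forall>n::nat. c * real n \<le> \<nu> (f [^]\<^bsub>swap_extension G\<^esub> n)"
    using linear_growth_of_stabilization[OF f stab] by blast
  obtain r where "quasi_morphism (swap_extension G) r" "homogeneous (swap_extension G) r" "c \<le> r f"
    using homogeneous_quasimorphism_of_linear_growth[OF f c] by blast
  moreover have "\<not> real_homomorphism (swap_extension G) r"
    using swap_extension_real_homomorphism_zero[OF assms(1,2) _ f] \<open>c \<le> r f\<close> \<open>0 < c\<close> by force
  ultimately show ?thesis
    by blast
qed

end
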